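(* Let $m,n\ge 1$ be integers. The sequence $d_1d_2\ldots d_{m^n}$ representing the game tree for the warden's game with $n$ $m$-sided dice is the lexicographically minimal $m$-ary de Bruijn sequence of rank $n$. That is, it is an $m$-ary de Bruijn sequence of rank $n$, and among all $m$-ary de Bruijn sequences of rank $n$ (written as words of length $m^n$) it is the lexicographically smallest.
   Context: De Bruijn sequences: given positive integers $m$ and $n$, an $m$-ary de Bruijn sequence of rank $n$ is a sequence of $m^n$ numbers from $\{0,\ldots,m-1\}$ such that each possible string of $n$ numbers from $\{0,\ldots,m-1\}$ appears exactly once in the sequence treated as a loop (i.e. as a block of $n$ cyclically consecutive terms, indices taken modulo $m^n$). The warden's game with $n$ $m$-sided dice: a position is a string $x_1x_2\ldots x_n$ with each $x_i\in\{0,1,\ldots,m-1\}$. There are two players, the prisoner and the warden, both with full information. In each move the rightmost die is transferred to the far left, possibly with a changed value, so that $x_1\ldots x_n$ becomes $c\,x_1\ldots x_{n-1}$ for some $c$ determined as follows. The warden first chooses either (i) to transfer the die himself, strictly decreasing its value, i.e. he chooses any $c$ with $0\le c<x_n$ (impossible if $x_n=0$), or (ii) to pass, in which case the prisoner must transfer the die and chooses any $c$ with $x_n\le c\le m-1$. The prisoner wins when the goal position, consisting of all $(m-1)$'s, is reached. Remoteness: $r(\beta)$ is the least $k\ge 1$ such that the prisoner has a strategy guaranteeing that, starting from position $\beta$, the goal position is reached after some number $t$ of moves with $1\le t\le k$ (so the goal position, treated as a starting position, has positive remoteness). It is known that for each $j\in\{1,\ldots,m^n\}$ there is exactly one position $p_j$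 with $r(p_j)=j$, and that $p_{m^n}$ is the goal position; put $p_0=p_{m^n}$. Since the optimal move from $p_{j}$ is to $p_{j-1}$, the last $n-1$ digits of $p_{j-1}$ are the first $n-1$ digits of $p_j$ for $1\le j\le m^n$. The sequence representing the game tree is $d_1d_2\ldots d_{m^n}$, where $d_j$ is the last digit of $p_j$. (For example, for $m=n=3$ it is $000100201101202102211121222$, and for $m=2$, $n=4$ it is $0000100110101111$.) *)

theory Defs
  imports Main "HOL-Library.List_Lexorder"
begin

text \<open>
  Strings are lists of natural numbers.  \<open>List_Lexorder\<close> makes \<open>\<le>\<close> on lists the lexicographic
  order.
\<close>

definition strings :: "nat \<Rightarrow> nat \<Rightarrow> nat list set" where
  "strings m n = {x. length x = n \<and> set x \<subseteq> {0..<m}}"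

definition de_bruijn :: "nat \<Rightarrow> nat \<Rightarrow> nat list \<Rightarrow> bool" where
  "de_bruijn m n s \<longleftrightarrow>
     s \<in> strings m (m ^ n) \<and>
     (\<forall>w \<in> strings m n. \<exists>!i. i < m ^ n \<and> (\<forall>j<n. s ! ((i + j) mod m ^ n) = w ! j))"

definition goal :: "nat \<Rightarrow> nat \<Rightarrow> nat list" where
  "goal m n = replicate n (m - 1)"

definition transfer :: "nat \<Rightarrow> nat list \<Rightarrow> nat list" where
  "transfer c x = c # butlast x"

text \<open>
  A strategy of the prisoner maps the list \<open>h\<close> of earlier positions (oldest first) and the
  current position \<open>x\<close> to the digit \<open>c\<close> used if the warden passes.  The positions alone reveal
  who moved, because the warden's digits are smaller than \<open>last x\<close> and the prisoner's are not.
\<close>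

type_synonym strategy = "nat list list \<Rightarrow> nat list \<Rightarrow> nat"

definition legal_strategy :: "nat \<Rightarrow> nat \<Rightarrow> strategy \<Rightarrow> bool" where
  "legal_strategy m n \<sigma> \<longleftrightarrow> (\<forall>h. \<forall>x \<in> strings m n. last x \<le> \<sigma> h x \<and> \<sigma> h x \<le> m - 1)"

text \<open>
  A play is an infinite sequence of positions; it is continued beyond the goal, which is harmless
  because only the first visit to the goal after the start matters.
\<close>

definition consistent_play :: "strategy \<Rightarrow> nat list \<Rightarrow> (nat \<Rightarrow> nat list) \<Rightarrow> bool" where
  "consistent_play \<sigma> \<beta> q \<longleftrightarrow>
     q 0 = \<beta> \<and>
     (\<forall>i. (\<exists>c < last (q i). q (Suc i) = transfer c (q i)) \<or>
          q (Suc i) = transfer (\<sigma> (map q [0..<i]) (q i)) (q i))"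

definition can_force :: "nat \<Rightarrow> nat \<Rightarrow> nat list \<Rightarrow> nat \<Rightarrow> bool" where
  "can_force m n \<beta> k \<longleftrightarrow>
     (\<exists>\<sigma>. legal_strategy m n \<sigma> \<and>
          (\<forall>q. consistent_play \<sigma> \<beta> q \<longrightarrow> (\<exists>t. 1 \<le> t \<and> t \<le> k \<and> q t = goal m n)))"

definition remoteness :: "nat \<Rightarrow> nat \<Rightarrow> nat list \<Rightarrow> nat" where
  "remoteness m n \<beta> = (LEAST k. 1 \<le> k \<and> can_force m n \<beta> k)"

text \<open>
  For \<open>1 \<le> j \<le> m ^ n\<close> there is exactly one position of remoteness \<open>j\<close>, so the definite description
  denotes it.
\<close>

definition position_at :: "nat \<Rightarrow> nat \<Rightarrow> nat \<Rightarrow> nat list" where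
  "position_at m n j = (THE x. x \<in> strings m n \<and> remoteness m n x = j)"

definition game_sequence :: "nat \<Rightarrow> nat \<Rightarrow> nat list" where
  "game_sequence m n = map (\<lambda>j. last (position_at m n j)) [1..<Suc (m ^ n)]"

end

theory Submission
  imports Defs
begin

text \<open>
  Let \<open>W k\<close> be the set of positions from which the prisoner can force the goal within \<open>k\<close> moves.
  Decreasing a digit \<open>c' < m - 1\<close> does not leave \<open>W k\<close>, so for each string \<open>y\<close> the digits \<open>c\<close> with
  \<open>c y\<close> in \<open>W k\<close> or equal to the goal form an initial segment, possibly with \<open>m - 1\<close> added. Hence
  \<open>y a\<close> lies in \<open>W (k + 1)\<close> iff \<open>a\<close> is less than the number of these digits, and counting shows that
  exactly one position is new at each step until the goal appears, which happens only when all
  positions are exhausted. Thus the game sequence is greedy: the digit following \<open>y\<close> is the least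
  \<open>a\<close> such that \<open>y a\<close> has not occurred.

  If a de Bruijn sequence \<open>s\<close> is lexicographically smaller, then at the first difference its window
  occurred before in the game sequence. Since \<open>s\<close> repeats no window, this must be one of the windows
  \<open>(m-1) \<dots> (m-1) 0 \<dots> 0\<close> (\<open>j\<close> zeros, \<open>1 \<le> j < n\<close>) wrapping around the start. But by then all
  positions ending in \<open>j\<close> zeros have been visited, so their nonzero continuations are used up; \<open>s\<close> has
  to continue with zeros and meets the string of \<open>n\<close> zeros a second time.
\<close>

section \<open>Positions, moves and backward induction\<close>

lemma strings_Cons [simp]: "c # y \<in> strings m n \<longleftrightarrow> c < m \<and> 0 < n \<and> y \<in> strings m (n - 1)"
  by (cases n) (auto simp: strings_def)

lemma strings_snoc [simp]: "y @ [a] \<in> strings m n \<longleftrightarrow> a < m \<and> 0 < n \<and> y \<in> strings m (n - 1)"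
  by (cases n) (auto simp: strings_def)

lemma finite_strings: "finite (strings m n)"
  using finite_lists_length_eq[of "{0..<m}" n] by (simp add: strings_def conj_commute)

lemma card_strings: "card (strings m n) = m ^ n"
  using card_lists_length_eq[of "{0..<m}" n] by (simp add: strings_def conj_commute)

lemma transfer_snoc [simp]: "transfer c (y @ [a]) = c # y"
  by (simp add: transfer_def)

lemma strings_transfer: "x \<in> strings m n \<Longrightarrow> n \<ge> 1 \<Longrightarrow> c < m \<Longrightarrow> transfer c x \<in> strings m n"
  by (cases x rule: rev_cases) (auto simp: strings_def)

lemma last_less: "x \<in> strings m n \<Longrightarrow> n \<ge> 1 \<Longrightarrow> last x < m"
  by (cases x rule: rev_cases) (auto simp: strings_def)

text \<open>Backward induction replaces strategies. The goal is adjoined at each step instead of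
  forming stage \<open>0\<close>, so that starting at the goal still costs at least one
  move.\<close>

fun forced :: "nat \<Rightarrow> nat \<Rightarrow> nat \<Rightarrow> nat list set" where
  "forced m n 0 = {}"
| "forced m n (Suc k) =
     {x \<in> strings m n. (\<forall>c < last x. transfer c x \<in> insert (goal m n) (forced m n k)) \<and>
       (\<exists>c \<in> {last x..<m}. transfer c x \<in> insert (goal m n) (forced m n k))}"

declare forced.simps(2) [simp del]

lemma forced_strings: "forced m n k \<subseteq> strings m n"
  by (cases k) (auto simp: forced.simps(2))

lemma forced_Suc_mono: "forced m n k \<subseteq> forced m n (Suc k)"
proof (induction k)
  case (Suc k)
  then show ?case by (auto 4 4 simp: forced.simps(2))
qed simp

lemma forced_mono: "k \<le> l \<Longrightarrow> forced m n k \<subseteq> forced m n l"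
  using lift_Suc_mono_le[of "forced m n", OF forced_Suc_mono] by blast

text \<open>The warden always passes. Every strategy thus admits a consistent play, so
  \<open>can_force\<close> with bound \<open>0\<close> is not vacuously true.\<close>

fun passive_play :: "strategy \<Rightarrow> nat list \<Rightarrow> nat \<Rightarrow> nat list" where
  "passive_play \<sigma> \<beta> 0 = \<beta>"
| "passive_play \<sigma> \<beta> (Suc i) =
     transfer (\<sigma> (map (passive_play \<sigma> \<beta>) [0..<i]) (passive_play \<sigma> \<beta> i)) (passive_play \<sigma> \<beta> i)"

lemma consistent_passive_play: "consistent_play \<sigma> \<beta> (passive_play \<sigma> \<beta>)"
  by (simp add: consistent_play_def)

text \<open>After the first move the prisoner follows \<open>\<sigma>\<close> with \<open>x\<close>
  prepended to the history. A play of this shifted strategy that avoids the goal would contradict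
  \<open>win\<close> once \<open>x\<close> is put in front.\<close>

lemma can_force_step:
  assumes "n \<ge> 1" "x \<in> strings m n" and legal: "legal_strategy m n \<sigma>"
    and win: "\<And>q. consistent_play \<sigma> x q \<Longrightarrow> \<exists>t. 1 \<le> t \<and> t \<le> Suc k \<and> q t = goal m n"
    and c: "c < last x \<or> c = \<sigma> [] x"
  shows "transfer c x = goal m n \<or> can_force m n (transfer c x) k"
proof (rule disjCI)
  assume nforce: "\<not> can_force m n (transfer c x) k"
  have "legal_strategy m n (\<lambda>h. \<sigma> (x # h))"
    using legal by (simp add: legal_strategy_def)
  with nforce obtain q where q: "consistent_play (\<lambda>h. \<sigma> (x # h)) (transfer c x) q"
    and avoid: "\<And>t. 1 \<le> t \<Longrightarrow> t \<le> k \<Longrightarrow> q t \<noteq> goal m n"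
    unfolding can_force_def by blast
  have map_case: "map (case_nat x q) [0..<Suc i] = x # map q [0..<i]" for i
    by (simp add: map_upt_Suc del: upt_Suc)
  have "consistent_play \<sigma> x (case_nat x q)"
    unfolding consistent_play_def
  proof (intro conjI allI)
    fix i
    show "(\<exists>c<last (case_nat x q i). case_nat x q (Suc i) = transfer c (case_nat x q i)) \<or>
       case_nat x q (Suc i) = transfer (\<sigma> (map (case_nat x q) [0..<i]) (case_nat x q i)) (case_nat x q i)"
    proof (cases i)
      case 0
      then show ?thesis using c q by (auto simp: consistent_play_def)
    next
      case (Suc j)
      show ?thesis using q unfolding Suc map_case by (simp add: consistent_play_def)
    qed
  qed simp
  from win[OF this] obtain t where t: "1 \<le> t" "t \<le> Suc k" "case_nat x q t = goal m n" by blast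
  then obtain u where "t = Suc u" by (cases t) auto
  with t avoid[of u] have "q 0 = goal m n" by (cases u) auto
  with q show "transfer c x = goal m n" by (simp add: consistent_play_def)
qed

lemma can_force_imp_forced:
  assumes "n \<ge> 1" "x \<in> strings m n" "can_force m n x k"
  shows "x \<in> forced m n k"
  using assms(2,3)
proof (induction k arbitrary: x)
  case 0
  then show ?case using consistent_passive_play by (fastforce simp: can_force_def)
next
  case (Suc k)
  then obtain \<sigma> where \<sigma>: "legal_strategy m n \<sigma>"
    "\<And>q. consistent_play \<sigma> x q \<Longrightarrow> \<exists>t. 1 \<le> t \<and> t \<le> Suc k \<and> q t = goal m n"
    unfolding can_force_def by blast
  have lx: "last x < m" using last_less Suc.prems(1) assms(1) by blast
  have "last x \<le> \<sigma> [] x \<and> \<sigma> [] x \<le> m - 1"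
    using \<sigma>(1) Suc.prems(1) by (simp add: legal_strategy_def)
  then have sx: "last x \<le> \<sigma> [] x" "\<sigma> [] x < m" using lx by linarith+
  have "transfer c x \<in> insert (goal m n) (forced m n k)" if "c < last x \<or> c = \<sigma> [] x" for c
    using can_force_step[OF assms(1) Suc.prems(1) \<sigma> that] Suc.IH strings_transfer[OF Suc.prems(1) assms(1)]
      that sx lx by fastforce
  then show ?case using Suc.prems sx by (auto simp: forced.simps(2) intro!: bexI[of _ "\<sigma> [] x"])
qed

text \<open>A positional strategy suffices: from \<open>z\<close>, first won at stage
  \<open>rk z\<close>, move to the goal or into stage \<open>rk z - 1\<close>.\<close>

lemma forced_imp_can_force:
  assumes "n \<ge> 1" "x \<in> forced m n k"
  shows "can_force m n x k"
proof -
  define good where "good j z c \<longleftrightarrow> last z \<le> c \<and> c < m \<and> transfer c z \<in> insert (goal m n) (forced m n (j - 1))"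
    for j z c
  define rk where "rk z = (LEAST j. z \<in> forced m n j)" for z
  define \<sigma> :: strategy where
    "\<sigma> h z = (if \<exists>j. z \<in> forced m n j then SOME c. good (rk z) z c else last z)" for h z
  have good: "good (rk z) z (\<sigma> h z)" if "z \<in> forced m n j" for h z j
  proof -
    have "z \<in> forced m n (rk z)" unfolding rk_def using that by (rule LeastI)
    then have "\<exists>c. good (rk z) z c" by (cases "rk z") (auto simp: good_def forced.simps(2))
    then have "good (rk z) z (SOME c. good (rk z) z c)" by (rule someI_ex)
    with that show ?thesis by (auto simp: \<sigma>_def)
  qed
  have "legal_strategy m n \<sigma>"
    unfolding legal_strategy_def
  proof (intro allI ballI)
    fix h z assume z: "z \<in> strings m n"
    show "last z \<le> \<sigma> h z \<and> \<sigma> h z \<le> m - 1"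
    proof (cases "\<exists>j. z \<in> forced m n j")
      case True
      then have "good (rk z) z (\<sigma> h z)" using good by blast
      then show ?thesis by (auto simp: good_def)
    next
      case False
      then show ?thesis using last_less[OF z assms(1)] by (simp add: \<sigma>_def)
    qed
  qed
  \<comment> \<open>The induction runs from an arbitrary time \<open>i\<close> of one play, since
    the history grows; \<open>k\<close> is only an upper bound for the rank of
    \<open>q i\<close>.\<close>
  moreover have "\<exists>t. i < t \<and> t \<le> i + k \<and> q t = goal m n"
    if q: "consistent_play \<sigma> x q" and "q i \<in> forced m n k" for q i k
    using that(2)
  proof (induction k arbitrary: i)
    case (Suc k)
    have rk: "rk (q i) \<le> Suc k" unfolding rk_def using Suc.prems by (rule Least_le)
    have "q (Suc i) \<in> insert (goal m n) (forced m n k)"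
    proof (cases "\<exists>c<last (q i). q (Suc i) = transfer c (q i)")
      case True
      then show ?thesis using Suc.prems by (auto simp: forced.simps(2))
    next
      case False
      then have "q (Suc i) = transfer (\<sigma> (map q [0..<i]) (q i)) (q i)"
        using q unfolding consistent_play_def by blast
      moreover have "forced m n (rk (q i) - 1) \<subseteq> forced m n k"
        using rk by (intro forced_mono) auto
      ultimately show ?thesis using good[OF Suc.prems] by (auto simp: good_def)
    qed
    then show ?case
    proof
      assume "q (Suc i) \<in> forced m n k"
      then obtain t where "Suc i < t" "t \<le> Suc i + k" "q t = goal m n" using Suc.IH by blast
      then show ?thesis by (intro exI[of _ t]) auto
    qed (auto intro!: exI[of _ "Suc i"])
  qed simp
  then have "\<exists>t. 1 \<le> t \<and> t \<le> k \<and> q t = goal m n" if "consistent_play \<sigma> x q" for q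
    using assms(2) that by (metis One_nat_def Suc_leI add_0 consistent_play_def)
  ultimately show ?thesis unfolding can_force_def by blast
qed

lemma remoteness_eq_Least_forced:
  assumes "n \<ge> 1" "x \<in> strings m n"
  shows "remoteness m n x = (LEAST k. x \<in> forced m n k)"
proof -
  have "1 \<le> k \<and> can_force m n x k \<longleftrightarrow> x \<in> forced m n k" for k
    using can_force_imp_forced[OF assms] forced_imp_can_force[OF assms(1)]
    by (cases k) auto
  then show ?thesis by (simp add: remoteness_def)
qed

section \<open>Counting the positions won within \<open>k\<close> moves\<close>

locale warden_game =
  fixes m n :: nat
  assumes m: "m \<ge> 1" and n: "n \<ge> 1"
begin

abbreviation W :: "nat \<Rightarrow> nat list set" where "W \<equiv> forced m n"

text \<open>All positions \<open>y @ [a]\<close> have the same successors \<open>c # y\<close>; the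
  digit \<open>a\<close> only decides who may choose which \<open>c\<close>.\<close>

definition digits_into :: "nat \<Rightarrow> nat list \<Rightarrow> nat set" where
  "digits_into k y = {c. c < m \<and> c # y \<in> insert (goal m n) (W k)}"

lemma finite_digits_into: "finite (digits_into k y)"
  by (simp add: digits_into_def)

lemma snoc_in_W_Suc:
  "y @ [a] \<in> W (Suc k) \<longleftrightarrow> a < m \<and> y \<in> strings m (n - 1) \<and>
     {..<a} \<subseteq> digits_into k y \<and> digits_into k y \<inter> {a..<m} \<noteq> {}"
  using n by (auto simp: digits_into_def forced.simps(2))

lemma goal_eq: "goal m n = (m - 1) # replicate (n - 1) (m - 1)"
  using n by (cases n) (auto simp: goal_def)

lemma goal_strings: "goal m n \<in> strings m n"
  using m by (auto simp: goal_def strings_def)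

text \<open>The bound \<open>c' < m - 1\<close> cannot be dropped: the goal counts as reached at time \<open>0\<close>, so positions
  leading to it come early. For \<open>m = n = 3\<close>, position \<open>220\<close> has remoteness \<open>1\<close> but \<open>210\<close> has \<open>17\<close>.\<close>

lemma W_decrease_digit:
  assumes "x @ c' # u \<in> W k" "c < c'" "c' < m - 1"
  shows "x @ c # u \<in> W k"
  using assms(1)
proof (induction k arbitrary: x u)
  case (Suc k)
  show ?case
  proof (cases u rule: rev_cases)
    case Nil
    then show ?thesis using Suc.prems assms(2,3) snoc_in_W_Suc[of x] by fastforce
  next
    case (snoc v b)
    have pr: "b < m" "x @ c' # v \<in> strings m (n - 1)" "{..<b} \<subseteq> digits_into k (x @ c' # v)"
      "digits_into k (x @ c' # v) \<inter> {b..<m} \<noteq> {}"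
      using Suc.prems snoc_in_W_Suc[of "x @ c' # v" b k] by (simp_all add: snoc)
    \<comment> \<open>The induction hypothesis covers \<open>W k\<close> only; the adjoined goal is
      excluded because it lacks the digit \<open>c'\<close>.\<close>
    have "c' \<in> set (e # x @ c' # v)" "c' \<notin> set (goal m n)" for e
      using assms(3) by (auto simp: goal_def)
    then have "e # x @ c' # v \<noteq> goal m n" for e by metis
    then have "digits_into k (x @ c' # v) \<subseteq> digits_into k (x @ c # v)"
      using Suc.IH[of "_ # x" v] by (auto simp: digits_into_def)
    moreover have "x @ c # v \<in> strings m (n - 1)"
      using pr(2) assms(2) by (auto simp: strings_def)
    ultimately show ?thesis
      using pr snoc_in_W_Suc[of "x @ c # v" b k] by (auto simp: snoc)
  qed
qed simp

lemma digits_into_downward: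
  assumes "c' \<in> digits_into k y" "c < c'" "c' < m - 1"
  shows "c \<in> digits_into k y"
  using assms W_decrease_digit[of "[]" c' y k c] by (auto simp: digits_into_def goal_eq)

text \<open>Since \<open>digits_into k y\<close> is an initial segment, possibly with
  \<open>m - 1\<close> added, containing all digits below \<open>a\<close> and one further digit is
  a matter of size alone.\<close>

lemma snoc_in_W_Suc_iff:
  "y @ [a] \<in> W (Suc k) \<longleftrightarrow> y \<in> strings m (n - 1) \<and> a < card (digits_into k y)"
proof -
  let ?A = "digits_into k y"
  have sub: "?A \<subseteq> {..<m}" by (auto simp: digits_into_def)
  have "a < m \<and> {..<a} \<subseteq> ?A \<and> ?A \<inter> {a..<m} \<noteq> {} \<longleftrightarrow> a < card ?A"
  proof (intro iffI conjI)
    assume "a < m \<and> {..<a} \<subseteq> ?A \<and> ?A \<inter> {a..<m} \<noteq> {}"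
    then obtain b where "b \<in> ?A" "a \<le> b" "insert b {..<a} \<subseteq> ?A" by auto
    then have "card (insert b {..<a}) \<le> card ?A" using finite_digits_into card_mono by blast
    then show "a < card ?A" using \<open>a \<le> b\<close> by (subst (asm) card_insert_disjoint) auto
  next
    assume a: "a < card ?A"
    show "a < m" using a card_mono[OF _ sub] by simp
    show "?A \<inter> {a..<m} \<noteq> {}"
    proof
      assume "?A \<inter> {a..<m} = {}"
      then have "?A \<subseteq> {..<a}" using sub by force
      then show False using a card_mono[of "{..<a}" ?A] by simp
    qed
    show "{..<a} \<subseteq> ?A"
    proof (rule ccontr)
      assume "\<not> {..<a} \<subseteq> ?A"
      then obtain c where c: "c < a" "c \<notin> ?A" by auto
      \<comment> \<open>By downward closure only \<open>m - 1\<close> can lie above the missing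
        digit \<open>c\<close>, which leaves at most \<open>c + 1 \<le> a\<close> elements.\<close>
      have "?A \<subseteq> insert (m - 1) {..<c}"
      proof
        fix e assume e: "e \<in> ?A"
        then show "e \<in> insert (m - 1) {..<c}"
          using c digits_into_downward[OF e, of c] sub by (cases e c rule: linorder_cases) force+
      qed
      then have "card ?A \<le> card (insert (m - 1) {..<c})" by (intro card_mono) auto
      also have "\<dots> \<le> Suc c" using card_insert_le_m1[of "Suc c" "{..<c}"] by simp
      finally show False using a c by simp
    qed
  qed
  then show ?thesis unfolding snoc_in_W_Suc by blast
qed

lemma finite_W: "finite (W k)"
  by (rule finite_subset[OF forced_strings finite_strings])

text \<open>Every \<open>y\<close> has as many extensions \<open>y a\<close> in \<open>W (k + 1)\<close> as extensions \<open>c y\<close> in \<open>W k\<close> together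
  with the goal.\<close>

lemma card_W_Suc: "card (W (Suc k)) = card (insert (goal m n) (W k))"
proof -
  let ?S = "strings m (n - 1)"
  have "W (Suc k) = (\<lambda>(y, a). y @ [a]) ` (SIGMA y:?S. {..<card (digits_into k y)})"
  proof (intro set_eqI iffI)
    fix x assume x: "x \<in> W (Suc k)"
    then have "x \<noteq> []" using n forced_strings[of m n "Suc k"] by (auto simp: strings_def)
    with x show "x \<in> (\<lambda>(y, a). y @ [a]) ` (SIGMA y:?S. {..<card (digits_into k y)})"
      using snoc_in_W_Suc_iff[of "butlast x" "last x" k]
      by (intro image_eqI[of _ _ "(butlast x, last x)"]) auto
  qed (auto simp: snoc_in_W_Suc_iff)
  then have "card (W (Suc k)) = (\<Sum>y\<in>?S. card (digits_into k y))"
    by (simp add: card_image inj_on_def finite_strings)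
  moreover have "insert (goal m n) (W k) = (\<lambda>(y, c). c # y) ` (SIGMA y:?S. digits_into k y)"
  proof (intro set_eqI iffI)
    fix x assume x: "x \<in> insert (goal m n) (W k)"
    then have "x \<in> strings m n" using forced_strings goal_strings by blast
    with x n show "x \<in> (\<lambda>(y, c). c # y) ` (SIGMA y:?S. digits_into k y)"
      by (cases x) (force simp: strings_def digits_into_def)+
  qed (auto simp: digits_into_def)
  then have "card (insert (goal m n) (W k)) = (\<Sum>y\<in>?S. card (digits_into k y))"
    by (simp add: card_image inj_on_def finite_strings finite_digits_into)
  ultimately show ?thesis by simp
qed

text \<open>As long as the goal is absent, adjoining it in \<open>card_W_Suc\<close> adds exactly
  one position per stage.\<close>

lemma card_W: "goal m n \<notin> W k \<Longrightarrow> card (W k) = k"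
proof (induction k)
  case (Suc k)
  then have "goal m n \<notin> W k" using forced_Suc_mono by blast
  then show ?case using Suc.IH finite_W card_W_Suc by simp
qed simp

text \<open>A position \<open>y @ [m - 1]\<close> is won only if all \<open>m\<close> digits put
  before \<open>y\<close> lead into the preceding stage or the goal. So trailing maximal digits can
  be traded one by one for arbitrary leading digits.\<close>

lemma W_fill:
  assumes "w @ replicate k (m - 1) \<in> W t" "x \<in> strings m k" "length w + k = n"
  shows "x @ w \<in> W t"
  using assms
proof (induction k arbitrary: w x)
  case 0
  then show ?case by (simp add: strings_def)
next
  case (Suc k)
  let ?y = "w @ replicate k (m - 1)"
  have w: "w @ replicate (Suc k) (m - 1) = ?y @ [m - 1]"
    by (simp add: replicate_append_same)
  obtain t' where t: "t = Suc t'" using Suc.prems by (cases t) auto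
  obtain x' c where x: "x = x' @ [c]" "x' \<in> strings m k" "c < m"
    using Suc.prems(2) by (cases x rule: rev_cases) (auto simp: strings_def)
  have "m - 1 < card (digits_into t' ?y)"
    using Suc.prems(1) unfolding w t snoc_in_W_Suc_iff by simp
  then have "digits_into t' ?y = {..<m}"
    by (intro card_seteq) (auto simp: digits_into_def)
  then have "c # ?y \<in> insert (goal m n) (W t')" using x by (auto simp: digits_into_def)
  then have "c # ?y \<in> W t"
  proof
    \<comment> \<open>In this case \<open>?y @ [m - 1]\<close> is the goal too, and it lies in
      \<open>W t\<close> by assumption.\<close>
    assume g: "c # ?y = goal m n"
    then have "w @ replicate (Suc k) (m - 1) = goal m n"
      unfolding w goal_def replicate_append_same[symmetric]
      by (metis goal_def goal_eq list.inject replicate_append_same)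
    then show ?thesis using g Suc.prems by simp
  qed (use forced_Suc_mono t in blast)
  then show ?case using Suc.IH[of "c # w" x'] x Suc.prems(3) by simp
qed

abbreviation N :: nat where "N \<equiv> m ^ n"

lemma N_pos: "N > 0"
  using m by simp

lemma goal_in_W_imp: "goal m n \<in> W k \<Longrightarrow> W k = strings m n"
  using W_fill[of "[]" n k] forced_strings[of m n k] by (auto simp: goal_def)

text \<open>Without the goal the stages would outgrow \<open>m ^ n\<close>, so it enters at a first
  stage \<open>K\<close>. That stage has \<open>K\<close> elements and, by
  \<open>goal_in_W_imp\<close>, contains every position.\<close>

lemma goal_in_W_iff: "goal m n \<in> W k \<longleftrightarrow> N \<le> k"
proof -
  have "\<exists>k. goal m n \<in> W k"
  proof (rule ccontr)
    assume "\<not> ?thesis"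
    then have "card (W (Suc N)) = Suc N" using card_W by blast
    then show False
      using card_mono[OF finite_strings forced_strings, of m n "Suc N"] card_strings[of m n] by linarith
  qed
  define K where "K = (LEAST k. goal m n \<in> W k)"
  have K: "goal m n \<in> W K" unfolding K_def using \<open>\<exists>k. goal m n \<in> W k\<close> by (rule LeastI_ex)
  then obtain j where j: "K = Suc j" by (cases K) auto
  have "goal m n \<notin> W j" using not_less_Least[of j "\<lambda>k. goal m n \<in> W k"] j K_def by auto
  then have "card (W K) = K" using card_W_Suc[of j] card_W[of j] finite_W j by simp
  then have "K = N" using goal_in_W_imp[OF K] card_strings by simp
  then show ?thesis
    using K forced_mono[of K k] not_less_Least[of k "\<lambda>k. goal m n \<in> W k"] unfolding K_def[symmetric]
    by (meson in_mono not_le)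
qed

lemma W_N: "W N = strings m n"
  using goal_in_W_iff goal_in_W_imp by blast

lemma card_W_le: "k \<le> N \<Longrightarrow> card (W k) = k"
  using card_W[of k] goal_in_W_iff[of k] W_N card_strings by (cases "k = N") auto

lemma W_Suc_singleton:
  assumes "k < N"
  obtains x where "W (Suc k) - W k = {x}"
proof -
  have "card (W (Suc k) - W k) = 1"
    using card_W_le[of k] card_W_le[of "Suc k"] assms card_Diff_subset[OF finite_W forced_Suc_mono]
    by simp
  then show ?thesis using that by (auto simp: card_1_singleton_iff)
qed

section \<open>Enumeration of the positions by remoteness\<close>

lemma remoteness_iff:
  "x \<in> strings m n \<and> remoteness m n x = Suc k \<longleftrightarrow> x \<in> W (Suc k) - W k"
proof (cases "x \<in> strings m n")
  case True
  then have ex: "\<exists>k. x \<in> W k" using W_N by blast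
  have "(LEAST k. x \<in> W k) = Suc k \<longleftrightarrow> x \<in> W (Suc k) \<and> x \<notin> W k"
  proof
    assume L: "(LEAST k. x \<in> W k) = Suc k"
    then show "x \<in> W (Suc k) \<and> x \<notin> W k"
      using LeastI_ex[OF ex] not_less_Least[of k "\<lambda>k. x \<in> W k"] by auto
  next
    assume R: "x \<in> W (Suc k) \<and> x \<notin> W k"
    show "(LEAST k. x \<in> W k) = Suc k"
    proof (rule Least_equality)
      fix j assume "x \<in> W j"
      then show "Suc k \<le> j" using R forced_mono[of j k] by (meson in_mono not_less_eq_eq)
    qed (use R in blast)
  qed
  then show ?thesis using True n remoteness_eq_Least_forced by auto
qed (use forced_strings in blast)

text \<open>The indices are read modulo \<open>m ^ n\<close>, so that \<open>P 0\<close> is the goal.\<close>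

definition P :: "nat \<Rightarrow> nat list" where
  "P t = (if t mod N = 0 then goal m n else position_at m n (t mod N))"

lemma position_at_Suc: "k < N \<Longrightarrow> W (Suc k) - W k = {position_at m n (Suc k)}"
proof (erule W_Suc_singleton)
  fix x assume x: "W (Suc k) - W k = {x}"
  have "position_at m n (Suc k) = x" unfolding position_at_def remoteness_iff x by simp
  then show ?thesis using x by simp
qed

lemma position_at_N: "position_at m n N = goal m n"
proof -
  obtain k where k: "N = Suc k" using N_pos by (cases N) auto
  have "goal m n \<in> W (Suc k) - W k" using goal_in_W_iff k by auto
  then show ?thesis using position_at_Suc[of k] k by auto
qed

lemma P_eq_position_at: "1 \<le> t \<Longrightarrow> t \<le> N \<Longrightarrow> P t = position_at m n t"
  by (cases "t = N") (auto simp: P_def position_at_N)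

lemma P_mod: "P (t mod N) = P t"
  by (simp add: P_def)

lemma P_0: "P 0 = goal m n"
  by (simp add: P_def)

lemma W_Suc_diff: "k < N \<Longrightarrow> W (Suc k) - W k = {P (Suc k)}"
  using position_at_Suc P_eq_position_at by simp

lemma W_Suc_eq: "k < N \<Longrightarrow> W (Suc k) = insert (P (Suc k)) (W k)"
  using W_Suc_diff forced_Suc_mono by blast

lemma W_eq_image: "k \<le> N \<Longrightarrow> W k = P ` {1..k}"
proof (induction k)
  case (Suc k)
  then show ?case by (simp add: W_Suc_eq atLeastAtMostSuc_conv)
qed simp

lemma inj_on_P: "inj_on P {1..N}"
  using W_eq_image[of N] card_W_le[of N] by (intro eq_card_imp_inj_on) auto

lemma P_strings: "P t \<in> strings m n"
proof -
  have "P (t mod N) \<in> insert (goal m n) (W (t mod N))"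
    using W_eq_image[of "t mod N"] N_pos by (cases "t mod N = 0") (auto simp: P_0)
  then show ?thesis using forced_strings goal_strings P_mod by auto
qed

lemma P_eq_iff: "P s = P t \<longleftrightarrow> s mod N = t mod N"
proof
  assume *: "P s = P t"
  \<comment> \<open>The representative of \<open>t\<close> modulo \<open>N\<close> in
    \<open>{1..N}\<close>, where \<open>P\<close> is injective.\<close>
  define f where "f t = (if t mod N = 0 then N else t mod N)" for t
  have f: "f t \<in> {1..N}" for t using N_pos by (auto simp: f_def)
  have Pf: "P (f t) = P t" for t using P_mod[of t] P_mod[of N] by (auto simp: f_def)
  have mod_neq: "a mod N \<noteq> N" for a using mod_less_divisor[OF N_pos, of a] by linarith
  have "f s = f t" using inj_onD[OF inj_on_P _ f f] Pf * by metis
  then show "s mod N = t mod N" 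
    by (simp add: f_def mod_neq mod_neq[symmetric] split: if_splits)
qed (metis P_mod)

text \<open>If \<open>y @ [a]\<close> is new at stage \<open>t + 1\<close>, the set of digits
  leading from \<open>y\<close> has just grown, and only the newcomer \<open>P t\<close> can account
  for that. A smaller digit gives another member of stage \<open>t + 1\<close>, hence one of stage
  \<open>t\<close>.\<close>

lemma P_Suc_greedy:
  assumes "t < N"
  shows "butlast (P (Suc t)) = tl (P t) \<and> (\<forall>b < last (P (Suc t)). tl (P t) @ [b] \<in> W t)"
proof -
  obtain y a where ya: "P (Suc t) = y @ [a]"
    using P_strings[of "Suc t"] n by (cases "P (Suc t)" rule: rev_cases) (auto simp: strings_def)
  have "y @ [a] \<in> W (Suc t) - W t" using W_Suc_diff[OF assms] ya by simp
  then have y: "y \<in> strings m (n - 1)" "a < card (digits_into t y)" and notin: "y @ [a] \<notin> W t"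
    using snoc_in_W_Suc_iff[of y a t] by simp_all
  obtain c where "c # y = P t"
  proof (cases t)
    \<comment> \<open>Stage \<open>0\<close> is empty, so the adjoined goal, which is
      \<open>P 0\<close>, is the only target.\<close>
    case 0
    have "digits_into t y \<noteq> {}" using y(2) by auto
    then show ?thesis using that 0 by (auto simp: digits_into_def P_0)
  next
    case (Suc k)
    then have "\<not> a < card (digits_into k y)" using notin y(1) snoc_in_W_Suc_iff[of y a k] by simp
    then have "\<not> digits_into t y \<subseteq> digits_into k y"
      using y(2) card_mono[OF finite_digits_into] by (meson less_le_trans)
    then obtain c where "c # y \<in> W t - W k" by (auto simp: digits_into_def)
    then have "c # y = P t" using W_Suc_diff[of k] assms Suc by auto
    then show ?thesis by (rule that)
  qed
  then have tl: "tl (P t) = y" by (metis list.sel(3))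
  have "y @ [b] \<in> W t" if "b < a" for b
  proof -
    have "y @ [b] \<in> W (Suc t)" using snoc_in_W_Suc_iff y that by simp
    then show ?thesis using W_Suc_eq[OF assms] ya that by simp
  qed
  then show ?thesis using ya tl by simp
qed

lemma length_P [simp]: "length (P t) = n"
  using P_strings[of t] by (simp add: strings_def)

lemma P_Suc: "P (Suc t) = tl (P t) @ [last (P (Suc t))]"
proof -
  have "P (Suc (t mod N)) = P (Suc t)" by (simp add: P_eq_iff mod_Suc_eq)
  moreover have "P (Suc t) \<noteq> []" using length_P[of "Suc t"] n by fastforce
  ultimately show ?thesis
    using P_Suc_greedy[of "t mod N"] N_pos P_mod[of t] by (metis append_butlast_last_id mod_less_divisor)
qed

lemma P_shift: "l + i < n \<Longrightarrow> P (t + l) ! i = P t ! (l + i)"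
proof (induction l arbitrary: i)
  case (Suc l)
  have "i < n - 1" using Suc.prems by simp
  then have "P (t + Suc l) ! i = tl (P (t + l)) ! i"
    using P_Suc[of "t + l"] by (metis add_Suc_right length_P length_tl nth_append)
  also have "\<dots> = P (t + l) ! Suc i" using Suc.prems by (simp add: nth_tl)
  finally show ?case using Suc by simp
qed simp

section \<open>The game sequence and its cyclic windows\<close>

lemma length_game_sequence: "length (game_sequence m n) = N"
  by (simp add: game_sequence_def del: upt_Suc)

lemma game_sequence_nth: "game_sequence m n ! (i mod N) = last (P (Suc i))"
proof -
  have "i mod N < N" using N_pos by simp
  then have "game_sequence m n ! (i mod N) = last (position_at m n (Suc (i mod N)))"
    unfolding game_sequence_def by (simp del: upt_Suc)
  also have "\<dots> = last (P (Suc (i mod N)))"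
    using \<open>i mod N < N\<close> by (simp add: P_eq_position_at)
  also have "P (Suc (i mod N)) = P (Suc i)" by (simp add: P_eq_iff mod_Suc_eq)
  finally show ?thesis .
qed

text \<open>The last digit of \<open>P (i + j + 1)\<close> has moved to place \<open>j\<close> in
  \<open>P (i + n)\<close>, so the window at index \<open>i\<close> is
  \<open>P (i + n)\<close>.\<close>

lemma P_nth: "j < n \<Longrightarrow> P (i + n) ! j = game_sequence m n ! ((i + j) mod N)"
proof -
  assume j: "j < n"
  have "P (i + n) ! j = P (Suc (i + j)) ! (n - 1)"
    using P_shift[of "n - 1 - j" j "Suc (i + j)"] j by simp
  also have "\<dots> = last (P (Suc (i + j)))"
    using n by (subst last_conv_nth) (auto simp flip: length_0_conv)
  finally show ?thesis by (simp add: game_sequence_nth)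
qed

lemma de_bruijn_game_sequence: "de_bruijn m n (game_sequence m n)"
  unfolding de_bruijn_def
proof (intro conjI ballI)
  have "game_sequence m n ! i < m" if "i < N" for i
    using game_sequence_nth[of i] that last_less[OF P_strings n] by simp
  then show "game_sequence m n \<in> strings m N"
    by (auto simp: strings_def length_game_sequence in_set_conv_nth)
next
  fix w assume w: "w \<in> strings m n"
  have eq: "(\<forall>j<n. game_sequence m n ! ((i + j) mod N) = w ! j) \<longleftrightarrow> P (i + n) = w" for i
    using w by (auto simp: list_eq_iff_nth_eq strings_def P_nth)
  have inj: "inj_on (\<lambda>i. P (i + n)) {..<N}"
  proof (rule inj_onI)
    fix i i' assume "i \<in> {..<N}" "i' \<in> {..<N}" "P (i + n) = P (i' + n)"
    then obtain q q' where "i + n + N * q = i' + n + N * q'"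
      by (auto simp: P_eq_iff nat_mod_eq_iff)
    then have "i + N * q = i' + N * q'" by simp
    then have "i mod N = i' mod N" using nat_mod_eq_iff by blast
    with \<open>i \<in> {..<N}\<close> \<open>i' \<in> {..<N}\<close> show "i = i'" by simp
  qed
  then have "(\<lambda>i. P (i + n)) ` {..<N} = strings m n"
    using P_strings by (intro card_subset_eq) (auto simp: card_image card_strings finite_strings)
  with w have "w \<in> (\<lambda>i. P (i + n)) ` {..<N}" by simp
  then obtain i where i: "w = P (i + n)" "i \<in> {..<N}" by (rule imageE)
  show "\<exists>!i. i < N \<and> (\<forall>j<n. game_sequence m n ! ((i + j) mod N) = w ! j)"
    unfolding eq
  proof (rule ex1I)
    show "i < N \<and> P (i + n) = w" using i by simp
    show "i' = i" if "i' < N \<and> P (i' + n) = w" for i'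
      using that i by (intro inj_onD[OF inj]) simp_all
  qed
qed


section \<open>Lexicographic minimality\<close>

text \<open>The greedy rule appends \<open>0\<close> because the result is new: every
  \<open>P l\<close> with \<open>1 \<le> l < j\<close> still has \<open>m - 1\<close> at place
  \<open>n - j\<close>, where the candidate has \<open>0\<close>.\<close>

lemma P_init:
  assumes "m \<ge> 2" "j \<le> n"
  shows "P j = replicate (n - j) (m - 1) @ replicate j 0"
  using assms(2)
proof (induction j rule: less_induct)
  case (less j)
  show ?case
  proof (cases j)
    case 0
    then show ?thesis by (simp add: P_0 goal_def)
  next
    case (Suc i)
    have "i < N" using less.prems Suc assms(1) less_exp[of n] power_mono[of 2 m n] by linarith
    have "P i = replicate (Suc (n - j)) (m - 1) @ replicate i 0"
      using less Suc by (simp add: Suc_diff_Suc del: replicate_Suc)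
    then have tl: "tl (P i) = replicate (n - j) (m - 1) @ replicate i 0" by simp
    have "last (P j) = 0"
    proof (rule ccontr)
      assume "last (P j) \<noteq> 0"
      then have "tl (P i) @ [0] \<in> W i" using P_Suc_greedy[OF \<open>i < N\<close>] Suc by simp
      then obtain l where l: "1 \<le> l" "l \<le> i" "tl (P i) @ [0] = P l"
        using W_eq_image[of i] \<open>i < N\<close> by auto
      have "(tl (P i) @ [0]) ! (n - j) = 0"
        unfolding tl using less.prems Suc by (simp add: nth_append)
      moreover have "P l ! (n - j) = m - 1"
        using less l Suc by (simp add: nth_append)
      ultimately show False using l(3) assms(1) by simp
    qed
    then show ?thesis using P_Suc[of i] tl Suc by (simp add: replicate_append_same)
  qed
qed

text \<open>The first visit to a position ending in \<open>k\<close> maximal digits is at \<open>0 \<dots> 0 (m-1) \<dots> (m-1)\<close>: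
  if it were \<open>w (m-1) \<dots> (m-1)\<close> with \<open>w\<close> nonzero, some position ending in \<open>w\<close>, visited by then,
  would contain \<open>k\<close> consecutive maximal digits at an earlier place.\<close>

lemma zeros_visited:
  assumes "m \<ge> 2" "1 \<le> k" "k < n" "1 \<le> t" "t \<le> N"
    and "drop (n - k) (P t) = replicate k (m - 1)" and "x \<in> strings m k"
  shows "x @ replicate (n - k) 0 \<in> W t"
proof -
  \<comment> \<open>\<open>T\<close> is the first visit after the start; \<open>1 \<le> t\<close>
    excludes \<open>P 0\<close>, the goal.\<close>
  define Q where "Q t \<longleftrightarrow> 1 \<le> t \<and> (\<forall>i<k. P t ! (n - k + i) = m - 1)" for t
  define T where "T = (LEAST t. Q t)"
  have "Q t"
    using assms(3,4) arg_cong[OF assms(6), of "\<lambda>x. x ! _"] by (auto simp: Q_def)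
  then have QT: "Q T" and "T \<le> t" unfolding T_def by (auto intro: LeastI Least_le)
  have least: "T \<le> u" if "Q u" for u unfolding T_def using that by (rule Least_le)
  define w where "w = take (n - k) (P T)"
  have w: "length w = n - k" by (simp add: w_def)
  have "drop (n - k) (P T) = replicate k (m - 1)"
    using QT assms(3) by (intro nth_equalityI) (auto simp: Q_def)
  then have PT: "P T = w @ replicate k (m - 1)" unfolding w_def by (metis append_take_drop_id)
  have "1 \<le> T" "T \<le> N" using QT \<open>T \<le> t\<close> assms(5) by (auto simp: Q_def)
  then have "P T \<in> W T" using W_eq_image by auto
  then have fill: "y @ w \<in> W T" if "y \<in> strings m k" for y
    using W_fill[of w k T y] PT w that assms(3) by simp
  have visit: "\<exists>u. 1 \<le> u \<and> u \<le> T \<and> P u = y @ w" if "y \<in> strings m k" for y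
    using fill[OF that] W_eq_image[OF \<open>T \<le> N\<close>] by auto
  have "w = replicate (n - k) 0"
  proof (cases "hd w = m - 1")
    case True
    then obtain w' where w': "w = (m - 1) # w'" using w assms(3) by (cases w) auto
    \<comment> \<open>With this filling and the maximal head of \<open>w\<close>, the position has
      \<open>k\<close> maximal digits from its second place on.\<close>
    have "0 # replicate (k - 1) (m - 1) \<in> strings m k"
      using assms(1,2) by (auto simp: strings_def)
    from visit[OF this] obtain u where u: "1 \<le> u" "u \<le> T"
      "P u = (0 # replicate (k - 1) (m - 1)) @ w" by blast
    then have Pu: "P u = 0 # replicate k (m - 1) @ w'"
      using w' assms(2) by (cases k) (simp_all add: replicate_append_same)
    have "n < u"
    proof (rule ccontr)
      assume "\<not> n < u"
      then have init: "P u = replicate (n - u) (m - 1) @ replicate u 0" using P_init[OF assms(1)] by simp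
      then have "n - u = 0" using Pu assms(1) by (cases "n - u") auto
      moreover have "m - 1 \<in> set (P u)" using Pu assms(2) by (cases k) auto
      ultimately show False using init assms(1) by auto
    qed
    \<comment> \<open>At time \<open>v\<close> these \<open>k\<close> digits were at the end, so
      \<open>T \<le> v \<le> u \<le> T\<close>; but \<open>P u\<close> begins with \<open>0\<close>
      and \<open>P T\<close> with \<open>m - 1\<close>.\<close>
    define v where "v = u - length w'"
    have v: "1 \<le> v" "u = v + length w'" using \<open>n < u\<close> w w' by (auto simp: v_def)
    have "P v ! (n - k + i) = m - 1" if "i < k" for i
    proof -
      have "n - k = Suc (length w')" using w w' by simp
      then have "P v ! (n - k + i) = P u ! Suc i"
        using P_shift[of "length w'" "Suc i" v] v that assms(3) by simp
      then show ?thesis using that by (simp add: Pu nth_append)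
    qed
    then have "T \<le> v" using least v by (simp add: Q_def)
    then have "u = T" using u v by simp
    then show ?thesis using Pu PT w' assms(1) by simp
  next
    case False
    have ones: "replicate k (m - 1) \<in> strings m k" using assms(1) by (auto simp: strings_def)
    obtain u where u: "1 \<le> u" "u \<le> T" "P u = replicate k (m - 1) @ w"
      using visit[OF ones] by blast
    \<comment> \<open>Otherwise the leading \<open>k\<close> maximal digits were at the end
      \<open>n - k\<close> steps earlier, before \<open>T\<close>.\<close>
    have "u \<le> n - k"
    proof (rule ccontr)
      assume "\<not> u \<le> n - k"
      define v where "v = u - (n - k)"
      have v: "1 \<le> v" "u = v + (n - k)" using \<open>\<not> u \<le> n - k\<close> by (auto simp: v_def)
      have "P v ! (n - k + i) = m - 1" if "i < k" for i
        using P_shift[of "n - k" i v] v that assms(3) u(3) by (simp add: nth_append)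
      then have "T \<le> v" using least v by (simp add: Q_def)
      then show False using u v assms(3) by simp
    qed
    then have init: "P u = replicate (n - u) (m - 1) @ replicate u 0" using P_init[OF assms(1)] by simp
    have "u = n - k"
    proof (rule ccontr)
      assume "u \<noteq> n - k"
      then have "k < n - u" using \<open>u \<le> n - k\<close> assms(3) by simp
      then have "P u ! k = m - 1" using init by (simp add: nth_append)
      moreover have "P u ! k = hd w" using u(3) w assms(3) by (cases w) (auto simp: nth_append)
      ultimately show False using False by simp
    qed
    then have "P u = replicate k (m - 1) @ replicate (n - k) 0" using init assms(3) by simp
    then show ?thesis using u(3) by simp
  qed
  then show ?thesis using fill[OF assms(7)] forced_mono[OF \<open>T \<le> t\<close>] by auto
qed

lemma de_bruijn_window_unique:
  assumes "de_bruijn m n s" "a < N" "b < N"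
    and "\<And>j. j < n \<Longrightarrow> s ! ((a + j) mod N) = s ! ((b + j) mod N)"
  shows "a = b"
proof -
  define w where "w = map (\<lambda>j. s ! ((a + j) mod N)) [0..<n]"
  have s: "s \<in> strings m N" using assms(1) by (simp add: de_bruijn_def)
  have "s ! (i mod N) < m" for i
  proof -
    have "i mod N < length s" using s N_pos by (simp add: strings_def)
    from nth_mem[OF this] show ?thesis using s by (auto simp: strings_def)
  qed
  then have "w \<in> strings m n" by (auto simp: w_def strings_def)
  then have "\<exists>!i. i < N \<and> (\<forall>j<n. s ! ((i + j) mod N) = w ! j)"
    using assms(1) by (simp add: de_bruijn_def)
  then show ?thesis using assms(2-4) by (auto simp: w_def)
qed

lemma n_less_N: "m \<ge> 2 \<Longrightarrow> n < N"
  using less_exp[of n] power_mono[of 2 m n] by linarith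

lemma game_sequence_minimal:
  assumes "m \<ge> 2" and s: "de_bruijn m n s"
  shows "game_sequence m n \<le> s"
proof (rule ccontr)
  let ?d = "game_sequence m n"
  let ?M = "m - 1"
  assume "\<not> ?d \<le> s"
  then have "s < ?d" by simp
  moreover have len: "length s = N" using s by (simp add: de_bruijn_def strings_def)
  ultimately obtain i where i: "i < N" "take i s = take i ?d" "s ! i < ?d ! i"
    by (auto simp: list_less_def lexord_take_index_conv length_game_sequence)
  have agree: "s ! l = ?d ! l" if "l < i" for l
    using i(2) that by (metis nth_take)
  have d_nth: "?d ! l = last (P (Suc l))" if "l < N" for l
    using game_sequence_nth[of l] that by simp
  have window: "P (n + e) ! l = ?d ! (e + l)" if "e + l < N" "l < n" for e l
    using P_nth[of l e] that by (simp add: add.commute)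
  have unique: "a = b" if "a + n \<le> N" "b + n \<le> N" "\<And>l. l < n \<Longrightarrow> s ! (a + l) = s ! (b + l)" for a b
  proof (rule de_bruijn_window_unique[OF s])
    fix l assume "l < n"
    then have "(a + l) mod N = a + l" "(b + l) mod N = b + l" using that by simp_all
    then show "s ! ((a + l) mod N) = s ! ((b + l) mod N)" using that(3)[OF \<open>l < n\<close>] by simp
  qed (use that n in linarith)+
  have d0: "?d ! l = 0" if "l < n" for l
    using window[of 0 l] P_init[of n] that assms(1) n_less_N by simp
  have "n \<le> i" using i(3) d0[of i] by (cases "n \<le> i") auto
  have s0: "s ! l = 0" if "l < n" for l using agree d0 that \<open>n \<le> i\<close> by simp
  define y where "y = tl (P i)"
  have y: "length y = n - 1" by (simp add: y_def)
  have y_nth: "y ! l = s ! (Suc i - n + l)" if "l < n - 1" for l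
  proof -
    have "y ! l = P i ! Suc l" unfolding y_def using that by (simp add: nth_tl)
    also have "\<dots> = ?d ! (i - n + Suc l)" using window[of "i - n" "Suc l"] that \<open>n \<le> i\<close> i(1) by simp
    also have "\<dots> = s ! (Suc i - n + l)" using agree[of "i - n + Suc l"] that \<open>n \<le> i\<close> by (simp add: Suc_diff_le)
    finally show ?thesis .
  qed
  \<comment> \<open>At the first difference \<open>s\<close> takes less than the greedy digit, so
    its window was visited at some time \<open>j \<le> i\<close>.\<close>
  have "y @ [s ! i] \<in> W i"
    using P_Suc_greedy[OF i(1)] d_nth[OF i(1)] i(3) by (simp add: y_def)
  then obtain j where j: "1 \<le> j" "j \<le> i" "y @ [s ! i] = P j"
    using W_eq_image[of i] i(1) by auto
  have Pj_nth: "P j ! l = s ! (Suc i - n + l)" if "l < n" for l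
    using y_nth[of l] y that \<open>n \<le> i\<close> unfolding j(3)[symmetric]
    by (cases "l = n - 1") (auto simp: nth_append)
  \<comment> \<open>For \<open>j \<ge> n\<close> the window \<open>P j\<close> lies within the
    common prefix, and \<open>s\<close> would repeat it.\<close>
  have "j < n"
  proof (rule ccontr)
    assume "\<not> j < n"
    have "j - n = Suc i - n"
    proof (rule unique)
      fix l assume l: "l < n"
      have "P j ! l = ?d ! (j - n + l)"
        using window[of "j - n" l] l \<open>\<not> j < n\<close> i(1) j(2) by simp
      also have "\<dots> = s ! (j - n + l)"
        using agree[of "j - n + l"] l \<open>\<not> j < n\<close> j(2) by simp
      finally show "s ! (j - n + l) = s ! (Suc i - n + l)" using Pj_nth[OF l] by simp
    qed (use i(1) j(2) \<open>n \<le> i\<close> \<open>\<not> j < n\<close> in linarith)+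
    then show False using j(2) \<open>\<not> j < n\<close> by simp
  qed
  have Pj: "P j = replicate (n - j) ?M @ replicate j 0" using P_init assms(1) \<open>j < n\<close> by simp
  \<comment> \<open>\<open>P (Suc i)\<close> agrees with \<open>P j\<close> except perhaps in the
    last digit; \<open>j\<close> steps earlier its \<open>n - j\<close> leading maximal digits were
    at the end.\<close>
  define t where "t = Suc i - j"
  have t: "n < t + j" "t + j = Suc i" "1 \<le> t" "t \<le> N"
    using \<open>j < n\<close> \<open>n \<le> i\<close> i(1) j by (auto simp: t_def)
  have Pi: "P (Suc i) ! l = P j ! l" if "l < n - 1" for l
  proof -
    have "P (Suc i) ! l = y ! l" unfolding y_def
      by (subst P_Suc) (use that in \<open>simp add: nth_append\<close>)
    then show ?thesis using j(3) y that by (metis nth_append)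
  qed
  have "drop j (P t) = replicate (n - j) ?M"
  proof (rule nth_equalityI)
    fix l assume "l < length (drop j (P t))"
    then have l: "l < n - j" by simp
    then have "drop j (P t) ! l = P (Suc i) ! l" using P_shift[of j l t] t(2) by simp
    also have "\<dots> = ?M" using Pi[of l] l j(1) Pj by (simp add: nth_append)
    finally show "drop j (P t) ! l = replicate (n - j) ?M ! l" using l by simp
  qed simp
  then have zeros: "x @ replicate j 0 \<in> W t" if "x \<in> strings m (n - j)" for x
    using zeros_visited[of "n - j" t x] that assms(1) \<open>j < n\<close> j(1) t by simp
  \<comment> \<open>From the first difference on, \<open>s\<close> can only continue with zeros;
    \<open>l\<close> counts the zeros ending the current window. At \<open>l = n\<close> the zero
    string recurs.\<close>
  have forced_zeros: "l \<le> n \<longrightarrow> i + (l - j) < N \<and>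
      (\<forall>e<n. s ! (Suc i - n + (l - j) + e) = (replicate (n - l) ?M @ replicate l 0) ! e)"
    if "j \<le> l" for l
    using that
  proof (induction l rule: dec_induct)
    case base
    then show ?case using Pj_nth Pj i(1) by simp
  next
    case (step l)
    show ?case
    proof
      assume "Suc l \<le> n"
      define g where "g = Suc i - n + (l - j)"
      have g: "g + n = Suc i + (l - j)" using \<open>n \<le> i\<close> by (simp add: g_def)
      have "g + n \<le> N" and s_nth: "\<And>e. e < n \<Longrightarrow> s ! (g + e) = (replicate (n - l) ?M @ replicate l 0) ! e"
        using step \<open>Suc l \<le> n\<close> g unfolding g_def by auto
      \<comment> \<open>If \<open>s\<close> ended here with its digit \<open>0\<close>, the window
        wrapping from index \<open>N - 1\<close> would be all zeros, like the one at
        \<open>0\<close>.\<close>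
      have "g + n \<noteq> N"
      proof
        assume gN: "g + n = N"
        have "\<not> n - 1 < n - l" using step(1) j(1) \<open>Suc l \<le> n\<close> by linarith
        then have "s ! (g + (n - 1)) = 0" using s_nth[of "n - 1"] n by (simp add: nth_append)
        moreover have "g + (n - 1) = N - 1" using gN n by linarith
        ultimately have "s ! (N - 1) = 0" by simp
        have "s ! ((N - 1 + e) mod N) = s ! ((0 + e) mod N)" if "e < n" for e
        proof (cases e)
          case 0
          have "(N - 1 + e) mod N = N - 1" using 0 N_pos by (metis add.right_neutral diff_less mod_less zero_less_one)
          then show ?thesis using \<open>s ! (N - 1) = 0\<close> s0[of 0] 0 n by simp
        next
          case (Suc f)
          then have "N - 1 + e = N + f" using N_pos by linarith
          then have "(N - 1 + e) mod N = f" using Suc that n_less_N[OF assms(1)] by simp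
          then show ?thesis using Suc that n_less_N[OF assms(1)] s0[of f] s0[of e] by simp
        qed
        then have "N - 1 = 0" using de_bruijn_window_unique[OF s, of "N - 1" 0] N_pos by simp
        then show False using n_less_N[OF assms(1)] n by simp
      qed
      then have "g + n < N" using \<open>g + n \<le> N\<close> by simp
      define a where "a = s ! (g + n)"
      define v where "v = replicate (n - Suc l) ?M @ replicate l 0"
      define z where "z = v @ [a]"
      have v: "length v = n - 1" using \<open>Suc l \<le> n\<close> by (simp add: v_def)
      have z_nth: "s ! (Suc g + e) = z ! e" if "e < n" for e
      proof (cases "e = n - 1")
        case True
        then have "Suc g + e = g + n" using n by simp
        then show ?thesis using True v by (simp add: z_def a_def nth_append)
      next
        case False
        have "replicate (n - l) ?M @ replicate l 0 = ?M # v"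
          using \<open>Suc l \<le> n\<close> by (simp add: v_def Suc_diff_Suc flip: append_Cons replicate_Suc)
        then have "s ! (Suc g + e) = v ! e"
          using s_nth[of "Suc e"] False that by simp
        moreover have "e < n - 1" using False that by linarith
        ultimately show ?thesis using v by (simp add: z_def nth_append)
      qed
      have "a \<in> set s" unfolding a_def using len \<open>g + n < N\<close> by (intro nth_mem) simp
      then have "a < m" using s by (auto simp: de_bruijn_def strings_def)
      \<comment> \<open>All \<open>c # v\<close> end in \<open>j\<close> zeros and are in
        \<open>W t\<close>, so \<open>v @ [a]\<close> has been visited by time \<open>t + 1\<close>.
        For \<open>a \<noteq> 0\<close> that visit is past the initial phase and gives a repeated
        window of \<open>s\<close>.\<close>
      have "a = 0"
      proof (rule ccontr)
        assume "a \<noteq> 0"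
        have "c # v \<in> W t" if "c < m" for c
        proof -
          have "c # v = (c # replicate (n - Suc l) ?M @ replicate (l - j) 0) @ replicate j 0"
            using step(1) by (simp add: v_def flip: replicate_add)
          moreover have "c # replicate (n - Suc l) ?M @ replicate (l - j) 0 \<in> strings m (n - j)"
            using that step(1) \<open>Suc l \<le> n\<close> assms(1) by (auto simp: strings_def)
          ultimately show ?thesis using zeros by metis
        qed
        then have "digits_into t v = {..<m}" by (auto simp: digits_into_def)
        moreover have "v \<in> strings m (n - 1)" using \<open>Suc l \<le> n\<close> assms(1) by (auto simp: v_def strings_def)
        ultimately have "z \<in> W (Suc t)"
          using snoc_in_W_Suc_iff[of v a t] \<open>a < m\<close> by (simp add: z_def)
        then have "z \<in> W (Suc i)" using forced_mono[of "Suc t" "Suc i"] t j(1) by auto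
        then obtain u where u: "1 \<le> u" "u \<le> Suc i" "z = P u"
          using W_eq_image[of "Suc i"] i(1) by auto
        have "last z = a" by (simp add: z_def)
        have "n \<le> u"
        proof (rule ccontr)
          assume "\<not> n \<le> u"
          then have "last (P u) = 0" using P_init[of u] assms(1) u(1) by simp
          then show False using u(3) \<open>last z = a\<close> \<open>a \<noteq> 0\<close> by simp
        qed
        \<comment> \<open>At place \<open>n - j - 1\<close> the string \<open>z\<close> has
          \<open>0\<close>, but \<open>P (Suc i)\<close> has \<open>m - 1\<close>.\<close>
        have "u \<noteq> Suc i"
        proof
          assume "u = Suc i"
          then have "z ! (n - j - 1) = P j ! (n - j - 1)"
            using Pi[of "n - j - 1"] u(3) j(1) \<open>j < n\<close> by simp
          also have "\<dots> = ?M" using Pj \<open>j < n\<close> by (simp add: nth_append)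
          finally show False using step(1) j(1) \<open>Suc l \<le> n\<close> assms(1)
            by (auto simp: z_def v_def nth_append split: if_splits)
        qed
        have "u - n = Suc g"
        proof (rule unique)
          fix e assume e: "e < n"
          have "s ! (u - n + e) = P u ! e"
            using agree[of "u - n + e"] window[of "u - n" e] \<open>u \<noteq> Suc i\<close> \<open>n \<le> u\<close> u(2) e i(1) by simp
          then show "s ! (u - n + e) = s ! (Suc g + e)" using z_nth[OF e] u(3) by simp
        qed (use u \<open>n \<le> u\<close> i(1) \<open>g + n < N\<close> in auto)
        then show False using g u(2) \<open>n \<le> u\<close> by simp
      qed
      then have "z = replicate (n - Suc l) ?M @ replicate (Suc l) 0"
        by (simp add: z_def v_def replicate_append_same)
      moreover have "Suc g = Suc i - n + (Suc l - j)" using step(1) by (simp add: g_def Suc_diff_le)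
      ultimately show "i + (Suc l - j) < N \<and> (\<forall>e<n. s ! (Suc i - n + (Suc l - j) + e) =
          (replicate (n - Suc l) ?M @ replicate (Suc l) 0) ! e)"
        using z_nth g \<open>g + n < N\<close> step(1) by (simp add: Suc_diff_le)
    qed
  qed
  have "0 = Suc i - n + (n - j)"
  proof (rule unique)
    fix e assume "e < n"
    then show "s ! (0 + e) = s ! (Suc i - n + (n - j) + e)"
      using forced_zeros[of n] \<open>j < n\<close> s0 by simp
  qed (use forced_zeros[of n] \<open>j < n\<close> \<open>n \<le> i\<close> n_less_N[OF assms(1)] in linarith)+
  then show False using \<open>j < n\<close> by simp
qed

end

theorem theorem5:
  fixes m n :: nat
  assumes "m \<ge> 1" and "n \<ge> 1"
  shows "de_bruijn m n (game_sequence m n) \<and>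
         (\<forall>s. de_bruijn m n s \<longrightarrow> game_sequence m n \<le> s)"
proof -
  interpret warden_game m n using assms by unfold_locales
  have "game_sequence m n \<le> s" if s: "de_bruijn m n s" for s
  proof (cases "m = 1")
    case True
    \<comment> \<open>Here \<open>0 = m - 1\<close>, and a word of length \<open>1 ^ n = 1\<close>
      over one digit is unique.\<close>
    have "s = replicate 1 0" if "de_bruijn m n s" for s
      using that True by (auto simp: de_bruijn_def strings_def length_Suc_conv)
    then show ?thesis using s de_bruijn_game_sequence by (metis order_refl)
  next
    case False
    then show ?thesis using game_sequence_minimal assms(1) s by simp
  qed
  then show ?thesis using de_bruijn_game_sequence by blast
qed

end
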